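(* For any $p>0$ and $\epsilon\in(0,0.9)$, any one-pass $(1+\epsilon,0.49)$-$L_{M_p}$-sampler (in the node-arrival streaming model) on a data stream of length $n$ needs $\Omega(n)$ bits of space.
   Context: Similarity graph. $U$ is a universe of items and $f:U\times U\to[0,1]$ is a symmetric similarity function with $f(x,x)=1$ for all $x\in U$. For a stream $\sigma=(\sigma_1,\dots,\sigma_n)\in U^n$, the degree of node $i\in[n]$ in the similarity graph $G^\sigma$ (complete graph on $[n]$ with self-loops, weights $w(i,j)=f(\sigma_i,\sigma_j)$) is $d_i=\sum_{j\in[n]} f(\sigma_i,\sigma_j)$, and $M_p(\sigma)=\sum_{i\in[n]} d_i^p$. Each stream position is a distinct node; node $i$ is represented by the pair $(i,\sigma_i)$. Sampler. A $(1+\epsilon,\delta)$-$L_{M_p}$-sampler on $G^\sigma$ fails with probability at most $\delta$ and, conditioned on no failure, outputs node $i$ with a probability $p_i$ satisfying $(1-\epsilon)\frac{d_i^{p}}{M_p(\sigma)}\le p_i\le(1+\epsilon)\frac{d_i^{p}}{M_p(\sigma)}$, for every $i\in[n]$. Node-arrival streaming model. The items $\sigma_1,\dots,\sigma_n$ arrive sequentially and the algorithm, which has access to $f$, makes one or more linear scans (passes) over them while maintaining a bounded memory state. Algorithms are randomized; the algorithm's guarantee is required for every universe $U$, every similarity function $f$ and every stream $\sigma$ of length $n$, and its space is the worst-case number of bits of memory. Throughout, $p$ is a constant; the constant hidden in $\Omega(\cdot)$ may depend on $p$. *)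

theory Defs
  imports "HOL-Probability.Probability"
begin

definition similarity_on :: "'x set \<Rightarrow> ('x \<Rightarrow> 'x \<Rightarrow> real) \<Rightarrow> bool" where
  "similarity_on U f \<longleftrightarrow>
     (\<forall>x\<in>U. \<forall>y\<in>U. 0 \<le> f x y \<and> f x y \<le> 1 \<and> f x y = f y x) \<and> (\<forall>x\<in>U. f x x = 1)"

definition streams_of_length :: "nat \<Rightarrow> 'x set \<Rightarrow> 'x list set" where
  "streams_of_length n U = {\<sigma>. set \<sigma> \<subseteq> U \<and> length \<sigma> = n}"

(* Nodes are numbered from 0; node i carries the item \<sigma> ! i, and the sum includes the self-loop. *)
definition degree_in :: "('x \<Rightarrow> 'x \<Rightarrow> real) \<Rightarrow> 'x list \<Rightarrow> nat \<Rightarrow> real" where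
  "degree_in f \<sigma> i = (\<Sum>j<length \<sigma>. f (\<sigma> ! i) (\<sigma> ! j))"

definition degree_moment :: "real \<Rightarrow> ('x \<Rightarrow> 'x \<Rightarrow> real) \<Rightarrow> 'x list \<Rightarrow> real" where
  "degree_moment p f \<sigma> = (\<Sum>i<length \<sigma>. degree_in f \<sigma> i powr p)"

(* A deterministic one-pass algorithm whose memory is a bit string. It reads the nodes as pairs
   (position, item). The answer None means failure. Only the memory kept between arrivals is
   charged. *)
record 'x streaming_alg =
  start :: "bool list"
  step :: "bool list \<Rightarrow> nat \<times> 'x \<Rightarrow> bool list"
  answer :: "bool list \<Rightarrow> (nat \<times> 'x) option"

definition memory_after :: "'x streaming_alg \<Rightarrow> (nat \<times> 'x) list \<Rightarrow> bool list" where
  "memory_after D ns = foldl (step D) (start D) ns"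

definition outcome :: "'x streaming_alg \<Rightarrow> 'x list \<Rightarrow> (nat \<times> 'x) option" where
  "outcome D \<sigma> = answer D (memory_after D (List.enumerate 0 \<sigma>))"

(* A randomized algorithm is a probability measure on deterministic ones: fixing the random bits
   leaves a deterministic algorithm, and the random bits are not charged as memory. The sigma-algebra
   is arbitrary, as long as the outcome is a random variable. *)
definition L_Mp_sampler_at ::
  "real \<Rightarrow> real \<Rightarrow> real \<Rightarrow> ('x \<Rightarrow> 'x \<Rightarrow> real) \<Rightarrow> 'x list \<Rightarrow> 'x streaming_alg measure \<Rightarrow> bool" where
  "L_Mp_sampler_at p \<epsilon> \<delta> f \<sigma> R \<longleftrightarrow>
     prob_space R \<and>
     (\<lambda>D. outcome D \<sigma>) \<in> measurable R (count_space UNIV) \<and>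
     \<P>(D in R. outcome D \<sigma> = None) \<le> \<delta> \<and>
     (AE D in R. outcome D \<sigma> \<noteq> None \<longrightarrow> (\<exists>i<length \<sigma>. outcome D \<sigma> = Some (i, \<sigma> ! i))) \<and>
     (\<forall>i<length \<sigma>.
        (1 - \<epsilon>) * (degree_in f \<sigma> i powr p / degree_moment p f \<sigma>)
          \<le> \<P>(D in R. outcome D \<sigma> = Some (i, \<sigma> ! i) \<bar> outcome D \<sigma> \<noteq> None) \<and>
        \<P>(D in R. outcome D \<sigma> = Some (i, \<sigma> ! i) \<bar> outcome D \<sigma> \<noteq> None)
          \<le> (1 + \<epsilon>) * (degree_in f \<sigma> i powr p / degree_moment p f \<sigma>))"

(* Access to U and f is modelled by letting the randomized algorithm depend on them without
   restriction. *)
definition L_Mp_sampler ::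
  "real \<Rightarrow> real \<Rightarrow> real \<Rightarrow> nat \<Rightarrow>
   ('x set \<Rightarrow> ('x \<Rightarrow> 'x \<Rightarrow> real) \<Rightarrow> 'x streaming_alg measure) \<Rightarrow> bool" where
  "L_Mp_sampler p \<epsilon> \<delta> n A \<longleftrightarrow>
     (\<forall>U f. similarity_on U f \<longrightarrow>
        (\<forall>\<sigma>\<in>streams_of_length n U. L_Mp_sampler_at p \<epsilon> \<delta> f \<sigma> (A U f)))"

(* The worst case is taken over universes with at most N items. Without such a cap, every sampler
   needs unboundedly many bits merely to report an item: on a constant stream it must return that
   item, which takes about log |U| bits. *)
definition uses_at_most_bits ::
  "nat \<Rightarrow> nat \<Rightarrow> ('x set \<Rightarrow> ('x \<Rightarrow> 'x \<Rightarrow> real) \<Rightarrow> 'x streaming_alg measure) \<Rightarrow> nat \<Rightarrow> bool" where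
  "uses_at_most_bits N n A s \<longleftrightarrow>
     (\<forall>U f. finite U \<and> card U \<le> N \<and> similarity_on U f \<longrightarrow>
        (\<forall>\<sigma>\<in>streams_of_length n U. \<forall>D\<in>space (A U f). \<forall>t\<le>n.
           length (memory_after D (take t (List.enumerate 0 \<sigma>))) \<le> s))"

end

theory Submission
  imports Defs
begin

text \<open>Reduction from INDEX. The first third of the stream encodes a bit string x, each bit x j by a
  block of K items (j, x j, l) with l < K. The remaining items (i, b, l) with l \<ge> K query position i:
  an item carrying the bit b is similar to exactly the block items carrying (i, b). So the query
  items with b = x i have degree K + 1, those with the wrong bit have degree 1, and every sampled
  item with index i votes for its bit b. Once (1 + K) powr p \<ge> 39, the correct votes outweigh the
  wrong ones by a constant, even after the distortion by 1 \<plusminus> \<epsilon> and with failures counted as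
  abstentions. The memory after the encoding part is thus a message from which a random bit of x
  can be guessed with constant advantage, so it has linearly many bits. K depends only on p.\<close>

section \<open>Guessing a random bit string from a short message\<close>

fun guess_score :: "bool \<Rightarrow> bool option \<Rightarrow> real" where
  "guess_score b None = 0"
| "guess_score b (Some c) = (if b = c then 1 else -1)"

text \<open>Hoeffding's lemma for a fair variable with values \<open>0\<close> and
  \<open>2 * y\<close>, whose exponential moment is \<open>E\<close>; the factor
  \<open>exp (- y)\<close> recentres it to a fair sign.\<close>

lemma cosh_le_exp_square:
  fixes y :: real
  assumes "y \<ge> 0"
  shows "exp y + exp (- y) \<le> 2 * exp (y\<^sup>2 / 2)"
proof -
  define E where "E = (1 + exp (2 * y)) / 2"
  have "E > 0"
    unfolding E_def by (simp add: add_pos_pos)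
  have "- (2 * y) * (1/2) + ln (1 + (1/2) * (exp (2 * y) - 1)) \<le> (2 * y)\<^sup>2 / 8"
    by (rule Hoeffdings_lemma_aux) (use assms in auto)
  moreover have "1 + (1/2) * (exp (2 * y) - 1) = E"
    by (simp add: E_def field_simps)
  moreover have "(2 * y)\<^sup>2 / 8 = y\<^sup>2 / 2"
    by (simp add: power_mult_distrib)
  ultimately have "ln E \<le> y + y\<^sup>2 / 2"
    by simp
  then have "E \<le> exp (y + y\<^sup>2 / 2)"
    using \<open>E > 0\<close> by (metis exp_le_cancel_iff exp_ln)
  then have "2 * E \<le> 2 * exp (y + y\<^sup>2 / 2)"
    by simp
  then have "1 + exp (2 * y) \<le> 2 * (exp y * exp (y\<^sup>2 / 2))"
    by (simp add: E_def exp_add)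
  then have "exp (- y) * (1 + exp (2 * y)) \<le> exp (- y) * (2 * (exp y * exp (y\<^sup>2 / 2)))"
    by (intro mult_left_mono) auto
  also have "exp (- y) * (2 * (exp y * exp (y\<^sup>2 / 2))) = 2 * exp (y\<^sup>2 / 2)"
    by (simp add: exp_minus)
  also have "exp (- y) * (1 + exp (2 * y)) = exp y + exp (- y)"
    by (simp add: distrib_left flip: exp_add)
  finally show ?thesis .
qed

text \<open>Exponential moments replace both the information-theoretic argument for INDEX and a union
  bound over the messages.\<close>

lemma card_messages_ge_exp:
  fixes \<mu> :: "(nat \<Rightarrow> bool) \<Rightarrow> 'c" and g :: "'c \<Rightarrow> nat \<Rightarrow> bool option" and m :: nat and \<gamma> :: real
  defines "X \<equiv> PiE {..<m} (\<lambda>_. UNIV :: bool set)"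
  assumes "\<gamma> \<ge> 0"
    and score: "\<gamma> * real m * 2 ^ m \<le> (\<Sum>x\<in>X. \<Sum>i<m. guess_score (x i) (g (\<mu> x) i))"
  shows "exp (\<gamma>\<^sup>2 * real m / 2) \<le> real (card (\<mu> ` X))"
proof -
  define S where "S x c = (\<Sum>i<m. guess_score (x i) (g c i))" for x c
  \<comment> \<open>The tangent point: the assumed average of \<open>S x (\<mu> x)\<close> is at
    least \<open>\<gamma> * real m\<close>, so the linear term
    \<open>\<gamma> * S x (\<mu> x) - a\<close> has nonnegative average over
    \<open>X\<close>.\<close>
  define a where "a = \<gamma>\<^sup>2 * real m"
  have fin: "finite X"
    unfolding X_def by (intro finite_PiE) auto
  have cardX: "real (card X) = 2 ^ m"
    unfolding X_def by (simp add: card_PiE)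
  \<comment> \<open>For a fixed message the guesses do not depend on \<open>x\<close>, so the sum
    factorises over the bits. An abstention gives the factor \<open>2\<close>, a genuine guess gives
    \<open>exp \<gamma> + exp (- \<gamma>)\<close>.\<close>
  have moment: "(\<Sum>x\<in>X. exp (\<gamma> * S x c)) \<le> (2 * exp (\<gamma>\<^sup>2 / 2)) ^ m" for c
  proof -
    have "(\<Sum>x\<in>X. exp (\<gamma> * S x c)) = (\<Sum>x\<in>X. \<Prod>i<m. exp (\<gamma> * guess_score (x i) (g c i)))"
      by (simp add: S_def sum_distrib_left exp_sum)
    also have "\<dots> = (\<Prod>i<m. \<Sum>b\<in>UNIV. exp (\<gamma> * guess_score b (g c i)))"
      unfolding X_def by (rule prod_sum_PiE[symmetric]) auto
    also have "\<dots> \<le> (\<Prod>i<m. 2 * exp (\<gamma>\<^sup>2 / 2))"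
    proof (intro prod_mono conjI sum_nonneg)
      fix i
      show "(\<Sum>b\<in>UNIV. exp (\<gamma> * guess_score b (g c i))) \<le> 2 * exp (\<gamma>\<^sup>2 / 2)"
        using cosh_le_exp_square[OF \<open>\<gamma> \<ge> 0\<close>]
        by (cases "g c i") (auto simp: UNIV_bool add.commute)
    qed auto
    finally show ?thesis by simp
  qed
  \<comment> \<open>the tangent to exp at a\<close>
  have tangent: "exp a * (1 + (\<gamma> * S x (\<mu> x) - a)) \<le> exp (\<gamma> * S x (\<mu> x))" for x
  proof -
    have "exp a * (1 + (\<gamma> * S x (\<mu> x) - a)) \<le> exp a * exp (\<gamma> * S x (\<mu> x) - a)"
      by (intro mult_left_mono exp_ge_add_one_self) auto
    then show ?thesis by (simp flip: exp_add)
  qed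
  have "a * 2 ^ m \<le> \<gamma> * (\<Sum>x\<in>X. S x (\<mu> x))"
    using mult_left_mono[OF score \<open>\<gamma> \<ge> 0\<close>]
    by (simp add: S_def a_def power2_eq_square mult.assoc)
  then have "exp a * 2 ^ m \<le> exp a * (2 ^ m + (\<gamma> * (\<Sum>x\<in>X. S x (\<mu> x)) - a * 2 ^ m))"
    by simp
  also have "\<dots> = (\<Sum>x\<in>X. exp a * (1 + (\<gamma> * S x (\<mu> x) - a)))"
    by (simp add: sum.distrib sum_subtractf cardX mult.commute flip: sum_distrib_left)
  also have "\<dots> \<le> (\<Sum>x\<in>X. exp (\<gamma> * S x (\<mu> x)))"
    by (intro sum_mono tangent)
  \<comment> \<open>Summing over all messages instead of the one sent for \<open>x\<close> decouples
    \<open>c\<close> from \<open>x\<close>; after the swap, the number of messages appears as a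
    factor.\<close>
  also have "\<dots> \<le> (\<Sum>x\<in>X. \<Sum>c\<in>\<mu> ` X. exp (\<gamma> * S x c))"
    using fin by (intro sum_mono member_le_sum) auto
  also have "\<dots> = (\<Sum>c\<in>\<mu> ` X. \<Sum>x\<in>X. exp (\<gamma> * S x c))"
    by (rule sum.swap)
  also have "\<dots> \<le> (\<Sum>c\<in>\<mu> ` X. (2 * exp (\<gamma>\<^sup>2 / 2)) ^ m)"
    by (intro sum_mono moment)
  also have "\<dots> = real (card (\<mu> ` X)) * exp (a / 2) * 2 ^ m"
    by (simp add: power_mult_distrib a_def mult_ac flip: exp_of_nat_mult)
  finally have "exp (a / 2) * exp (a / 2) \<le> real (card (\<mu> ` X)) * exp (a / 2)"
    by (simp flip: exp_add)
  then show ?thesis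
    by (simp add: a_def)
qed

section \<open>Expected value of a score of the sampled node\<close>

text \<open>Almost surely the outcome is failure or an actual node, so the score agrees almost
  everywhere with a finite combination of indicators; with \<open>\<phi> None = 0\<close>, failure
  contributes no term.\<close>

lemma sampler_expectation:
  fixes \<phi> :: "(nat \<times> 'x) option \<Rightarrow> real"
  assumes samp: "L_Mp_sampler_at p \<epsilon> \<delta> f \<sigma> R" and none: "\<phi> None = 0"
  defines "P t \<equiv> \<P>(D in R. outcome D \<sigma> = Some (t, \<sigma> ! t))"
  shows "integrable R (\<lambda>D. \<phi> (outcome D \<sigma>))"
    and "(\<integral>D. \<phi> (outcome D \<sigma>) \<partial>R) = (\<Sum>t<length \<sigma>. \<phi> (Some (t, \<sigma> ! t)) * P t)"
proof -
  interpret prob_space R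
    using samp by (simp add: L_Mp_sampler_at_def)
  have meas: "(\<lambda>D. outcome D \<sigma>) \<in> measurable R (count_space UNIV)"
    using samp by (simp add: L_Mp_sampler_at_def)
  define B where "B t = {D \<in> space R. outcome D \<sigma> = Some (t, \<sigma> ! t)}" for t
  define h where "h D = (\<Sum>t<length \<sigma>. \<phi> (Some (t, \<sigma> ! t)) * indicator (B t) D)" for D
  have [measurable]: "B t \<in> sets R" for t
    unfolding B_def using measurable_sets[OF meas, of "{Some (t, \<sigma> ! t)}"]
    by (simp add: vimage_def Int_def conj_commute)
  have eq: "AE D in R. h D = \<phi> (outcome D \<sigma>)"
  proof -
    have "AE D in R. outcome D \<sigma> \<noteq> None \<longrightarrow> (\<exists>i<length \<sigma>. outcome D \<sigma> = Some (i, \<sigma> ! i))"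
      using samp by (simp add: L_Mp_sampler_at_def)
    with AE_space show ?thesis
    proof eventually_elim
      case (elim D)
      show ?case
      proof (cases "outcome D \<sigma>")
        case None
        then show ?thesis
          by (simp add: h_def B_def none)
      next
        case (Some _)
        then obtain i where i: "i < length \<sigma>" "outcome D \<sigma> = Some (i, \<sigma> ! i)"
          using elim by auto
        have "h D = (\<Sum>t<length \<sigma>. if t = i then \<phi> (Some (i, \<sigma> ! i)) else 0)"
          unfolding h_def B_def using i elim by (intro sum.cong) (auto simp: indicator_def)
        then show ?thesis using i by simp
      qed
    qed
  qed
  have int: "integrable R h"
    unfolding h_def by (intro Bochner_Integration.integrable_sum integrable_mult_right integrable_real_indicator)
      (auto simp: emeasure_eq_measure)
  have bm: "(\<lambda>D. \<phi> (outcome D \<sigma>)) \<in> borel_measurable R"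
    using measurable_compose[OF meas, of \<phi> borel] by simp
  show "integrable R (\<lambda>D. \<phi> (outcome D \<sigma>))"
    using integrable_cong_AE_imp[OF int bm] eq by simp
  have "(\<integral>D. \<phi> (outcome D \<sigma>) \<partial>R) = (\<integral>D. h D \<partial>R)"
    using eq by (intro integral_cong_AE bm borel_measurable_integrable[OF int]) auto
  also have "\<dots> = (\<Sum>t<length \<sigma>. \<phi> (Some (t, \<sigma> ! t)) * P t)"
    unfolding h_def P_def B_def[symmetric]
    by (subst Bochner_Integration.integral_sum) (auto simp: emeasure_eq_measure)
  finally show "(\<integral>D. \<phi> (outcome D \<sigma>) \<partial>R) = (\<Sum>t<length \<sigma>. \<phi> (Some (t, \<sigma> ! t)) * P t)" .
qed

text \<open>The sampler guarantee is conditional on success. Multiplying by the success probability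
  \<open>q\<close>, positive because \<open>\<delta> < 1\<close>, makes it unconditional; the same
  \<open>q\<close> serves all nodes.\<close>

lemma sampler_node_probability:
  fixes f :: "'x \<Rightarrow> 'x \<Rightarrow> real" and \<sigma> :: "'x list"
  assumes samp: "L_Mp_sampler_at p \<epsilon> \<delta> f \<sigma> R" and "\<delta> < 1" and t: "t < length \<sigma>"
  defines "q \<equiv> \<P>(D in R. outcome D \<sigma> \<noteq> None)"
    and "P \<equiv> \<P>(D in R. outcome D \<sigma> = Some (t, \<sigma> ! t))"
    and "w \<equiv> degree_in f \<sigma> t powr p / degree_moment p f \<sigma>"
  shows "q \<ge> 1 - \<delta>" and "q * ((1 - \<epsilon>) * w) \<le> P" and "P \<le> q * ((1 + \<epsilon>) * w)"
proof -
  interpret prob_space R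
    using samp by (simp add: L_Mp_sampler_at_def)
  have meas: "(\<lambda>D. outcome D \<sigma>) \<in> measurable R (count_space UNIV)"
    using samp by (simp add: L_Mp_sampler_at_def)
  have "{D \<in> space R. outcome D \<sigma> = None} \<in> sets R"
    using measurable_sets[OF meas, of "{None}"] by (simp add: vimage_def Int_def conj_commute)
  then have "q = 1 - \<P>(D in R. outcome D \<sigma> = None)"
    unfolding q_def by (rule prob_neg)
  then show q: "q \<ge> 1 - \<delta>"
    using samp by (simp add: L_Mp_sampler_at_def)
  have "\<P>(D in R. outcome D \<sigma> = Some (t, \<sigma> ! t) \<bar> outcome D \<sigma> \<noteq> None) = P / q"
    unfolding cond_prob_def P_def q_def by (intro arg_cong2[where f = "(/)"] arg_cong[where f = prob]) auto
  then have "(1 - \<epsilon>) * w \<le> P / q" "P / q \<le> (1 + \<epsilon>) * w"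
    using samp t unfolding L_Mp_sampler_at_def w_def by auto
  moreover have "q > 0"
    using q \<open>\<delta> < 1\<close> by simp
  ultimately show "q * ((1 - \<epsilon>) * w) \<le> P" "P \<le> q * ((1 + \<epsilon>) * w)"
    by (simp_all add: field_simps)
qed

section \<open>The hard streams\<close>

text \<open>The parity of \<open>t - L\<close> makes both query bits equally frequent. For
  \<open>K > 0\<close> the last coordinate separates block items from query items and keeps all
  items distinct.\<close>

definition hard_item :: "nat \<Rightarrow> nat \<Rightarrow> (nat \<Rightarrow> bool) \<Rightarrow> nat \<Rightarrow> nat \<Rightarrow> nat \<times> bool \<times> nat" where
  "hard_item K L x i t =
     (if t < L then (t div K, x (t div K), t mod K) else (i, odd (t - L), K + (t - L)))"

text \<open>For each index and bit, the block items and the query items form a complete bipartite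
  graph with self-loops. Having no edges inside a side keeps wrong query items isolated from one
  another.\<close>

fun hard_similarity :: "nat \<Rightarrow> nat \<times> bool \<times> nat \<Rightarrow> nat \<times> bool \<times> nat \<Rightarrow> real" where
  "hard_similarity K (j, b, l) (j', b', l') =
     (if j = j' \<and> b = b' \<and> (l = l' \<or> (l < K) \<noteq> (l' < K)) then 1 else 0)"

definition hard_stream :: "nat \<Rightarrow> nat \<Rightarrow> nat \<Rightarrow> (nat \<Rightarrow> bool) \<Rightarrow> nat \<Rightarrow> nat list" where
  "hard_stream K L N x i = map (to_nat \<circ> hard_item K L x i) [0..<L + 2 * N]"

text \<open>The target statement concerns items of type \<open>nat\<close>, so the triples are
  transported along the countable encoding.\<close>

definition coded_similarity :: "nat \<Rightarrow> nat \<Rightarrow> nat \<Rightarrow> real" where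
  "coded_similarity K u v = hard_similarity K (from_nat u) (from_nat v)"

text \<open>Depends on neither \<open>x\<close> nor \<open>i\<close>, so a single randomized
  algorithm has to handle all hard streams.\<close>

definition hard_universe :: "nat \<Rightarrow> nat \<Rightarrow> nat \<Rightarrow> nat set" where
  "hard_universe K L N = to_nat ` ({..L} \<times> (UNIV :: bool set) \<times> {..<K + 2 * N})"

text \<open>Block items of index \<open>i\<close> vote as well as query items; they carry the true
  bit, so only query items can vote wrongly.\<close>

fun bit_guess :: "nat \<Rightarrow> (nat \<times> nat) option \<Rightarrow> bool option" where
  "bit_guess i None = None"
| "bit_guess i (Some (t, u)) = (case from_nat u of (j, b, l :: nat) \<Rightarrow> if j = i then Some b else None)"

lemma similarity_on_coded: "similarity_on U (coded_similarity K)"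
proof -
  have "coded_similarity K x y = coded_similarity K y x" for x y
    unfolding coded_similarity_def
    by (cases "(K, from_nat x :: nat \<times> bool \<times> nat, from_nat y :: nat \<times> bool \<times> nat)" rule: hard_similarity.cases) auto
  moreover have "0 \<le> coded_similarity K x y \<and> coded_similarity K x y \<le> 1" for x y
    unfolding coded_similarity_def
    by (cases "(K, from_nat x :: nat \<times> bool \<times> nat, from_nat y :: nat \<times> bool \<times> nat)" rule: hard_similarity.cases) auto
  moreover have "coded_similarity K x x = 1" for x
    unfolding coded_similarity_def by (cases "from_nat x :: nat \<times> bool \<times> nat") auto
  ultimately show ?thesis
    by (simp add: similarity_on_def)
qed

lemma card_hard_universe: "card (hard_universe K L N) = (L + 1) * (2 * (K + 2 * N))"
  unfolding hard_universe_def
  by (subst card_image) (auto simp: card_cartesian_product card_UNIV_bool)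

lemma finite_hard_universe: "finite (hard_universe K L N)"
  by (simp add: hard_universe_def)

lemma hard_stream_in_streams:
  assumes "K > 0" "i \<le> L"
  shows "hard_stream K L N x i \<in> streams_of_length (L + 2 * N) (hard_universe K L N)"
proof -
  have "hard_item K L x i t \<in> {..L} \<times> UNIV \<times> {..<K + 2 * N}" if "t < L + 2 * N" for t
  proof -
    have "t mod K < K"
      using assms by auto
    moreover have "t div K \<le> L" if "t < L"
      using div_le_dividend[of t K] that by linarith
    ultimately show ?thesis
      using assms that by (auto simp: hard_item_def intro: trans_less_add1)
  qed
  then show ?thesis
    unfolding streams_of_length_def hard_stream_def hard_universe_def by auto
qed

lemma hard_item_eq_iff:
  assumes "K > 0"
  shows "hard_item K L x i t = hard_item K L x i t' \<longleftrightarrow> t = t'"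
proof
  assume eq: "hard_item K L x i t = hard_item K L x i t'"
  have "t mod K < K" "t' mod K < K"
    using assms by auto
  then have "snd (snd (hard_item K L x i t)) < K \<longleftrightarrow> t < L" for t
    using assms by (auto simp: hard_item_def)
  with eq have "(t < L) = (t' < L)"
    by metis
  then show "t = t'"
  proof (cases "t < L")
    case True
    with eq \<open>(t < L) = (t' < L)\<close> have "t div K = t' div K" "t mod K = t' mod K"
      by (simp_all add: hard_item_def)
    then show ?thesis
      by (metis div_mult_mod_eq)
  next
    case False
    with eq \<open>(t < L) = (t' < L)\<close> have "K + (t - L) = K + (t' - L)" "\<not> t' < L"
      by (simp_all add: hard_item_def)
    with False show ?thesis
      by linarith
  qed
qed simp

text \<open>Only the last 2N nodes depend on i and only the first L nodes depend on x.\<close>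

lemma outcome_hard_stream:
  "\<exists>g. \<forall>x i. outcome D (hard_stream K L N x i) =
     g (memory_after D (take L (List.enumerate 0 (hard_stream K L N x i)))) i"
proof -
  have split: "List.enumerate 0 (hard_stream K L N x i) =
      map (\<lambda>t. (t, to_nat (hard_item K L x i t))) [0..<L] @
      map (\<lambda>t. (t, to_nat (hard_item K L x i t))) [L..<L + 2 * N]" for x i
    unfolding hard_stream_def enumerate_map_upt by (simp add: upt_add_eq_append[of 0 L "2 * N"])
  \<comment> \<open>The continuation of the algorithm on the query part. That part does not read the
    bit string, so \<open>undefined\<close> serves as a placeholder for it.\<close>
  define g where "g c i = answer D (foldl (step D) c
    (map (\<lambda>t. (t, to_nat (hard_item K L undefined i t))) [L..<L + 2 * N]))" for c i
  have suffix: "map (\<lambda>t. (t, to_nat (hard_item K L x i t))) [L..<L + 2 * N] =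
      map (\<lambda>t. (t, to_nat (hard_item K L undefined i t))) [L..<L + 2 * N]" for x i
    by (simp add: hard_item_def)
  have "outcome D (hard_stream K L N x i) =
      g (foldl (step D) (start D) (map (\<lambda>t. (t, to_nat (hard_item K L x i t))) [0..<L])) i" for x i
    by (simp only: outcome_def memory_after_def split g_def foldl_append suffix[of x i])
  then show ?thesis
    by (auto simp: memory_after_def split)
qed

lemma memory_prefix_hard_stream:
  "memory_after D (take L (List.enumerate 0 (hard_stream K L N x i))) =
   memory_after D (take L (List.enumerate 0 (hard_stream K L N x j)))"
proof -
  have "take L (List.enumerate 0 (hard_stream K L N x i)) =
      map (\<lambda>t. (t, to_nat (hard_item K L x 0 t))) [0..<L]" for i
    unfolding hard_stream_def
    by (simp add: enumerate_map_upt take_map hard_item_def)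
  then show ?thesis by simp
qed

section \<open>Degrees in the hard streams\<close>

lemma degree_hard_stream:
  assumes "t < L + 2 * N"
  shows "degree_in (coded_similarity K) (hard_stream K L N x i) t =
    (\<Sum>j<L + 2 * N. hard_similarity K (hard_item K L x i t) (hard_item K L x i j))"
  using assms by (simp add: degree_in_def hard_stream_def coded_similarity_def)

lemma hard_similarity_nonneg: "0 \<le> hard_similarity K u v"
  by (cases "(K, u, v)" rule: hard_similarity.cases) auto

lemma hard_similarity_refl: "hard_similarity K u u = 1"
  by (cases u) auto

lemma degree_ge_card:
  assumes "t < L + 2 * N" "J \<subseteq> {..<L + 2 * N}"
    and "\<And>j. j \<in> J \<Longrightarrow> hard_similarity K (hard_item K L x i t) (hard_item K L x i j) = 1"
  shows "real (card J) \<le> degree_in (coded_similarity K) (hard_stream K L N x i) t"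
proof -
  have "real (card J) = (\<Sum>j\<in>J. hard_similarity K (hard_item K L x i t) (hard_item K L x i j))"
    using assms by simp
  also have "\<dots> \<le> degree_in (coded_similarity K) (hard_stream K L N x i) t"
    unfolding degree_hard_stream[OF assms(1)] using assms(2)
    by (intro sum_mono2) (auto simp: hard_similarity_nonneg)
  finally show ?thesis .
qed

lemma degree_ge_1:
  assumes "t < L + 2 * N"
  shows "1 \<le> degree_in (coded_similarity K) (hard_stream K L N x i) t"
  using degree_ge_card[of t L N "{t}" K x i] assms by (simp add: hard_similarity_refl)

text \<open>A score other than 1 leaves two cases. A wrong query item meets no block item, since
  block \<open>i\<close> carries only \<open>x i\<close>; a block item of another index meets no
  query item, since these all have index \<open>i\<close>. In both cases only the self-loop
  remains.\<close>

lemma degree_eq_1: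
  assumes "K > 0" "t < L + 2 * N"
    and "guess_score (x i) (bit_guess i (Some (t, hard_stream K L N x i ! t))) \<noteq> 1"
  shows "degree_in (coded_similarity K) (hard_stream K L N x i) t = 1"
proof -
  have "hard_similarity K (hard_item K L x i t) (hard_item K L x i j) = (if j = t then 1 else 0)"
    for j
  proof (cases "j = t")
    case False
    then have "hard_item K L x i t \<noteq> hard_item K L x i j"
      using hard_item_eq_iff[OF assms(1)] by metis
    moreover have "t mod K < K" "j mod K < K"
      using assms by auto
    moreover have "t < L \<Longrightarrow> (t div K, x (t div K)) \<noteq> (i, x i)" "\<not> t < L \<Longrightarrow> odd (t - L) \<noteq> x i"
      using assms(2,3) by (auto simp: hard_item_def hard_stream_def split: if_splits)
    ultimately show ?thesis
      using False by (cases "t < L"; cases "j < L") (simp_all add: hard_item_def, auto)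
  qed (simp add: hard_similarity_refl)
  then show ?thesis
    using assms(2) by (simp add: degree_hard_stream)
qed

text \<open>The neighbours counted are the node itself and block \<open>i\<close>, which is complete
  because \<open>(i + 1) * K \<le> L\<close>.\<close>

lemma degree_good:
  assumes "K > 0" "(i + 1) * K \<le> L" "L \<le> t" "t < L + 2 * N" "odd (t - L) = x i"
  shows "1 + real K \<le> degree_in (coded_similarity K) (hard_stream K L N x i) t"
proof -
  let ?J = "insert t {i * K..<i * K + K}"
  have item_t: "hard_item K L x i t = (i, x i, K + (t - L))"
    using assms by (simp add: hard_item_def del: even_diff_nat)
  have J_L: "j < L" if "j \<in> {i * K..<i * K + K}" for j
    using that assms(2) by (auto simp: algebra_simps)
  have block: "hard_item K L x i j = (i, x i, j mod K)" if "j \<in> {i * K..<i * K + K}" for j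
  proof -
    have "j div K = i"
      using that by (auto intro!: div_nat_eqI simp: algebra_simps)
    then show ?thesis
      using J_L[OF that] by (simp add: hard_item_def)
  qed
  have "real (card ?J) \<le> degree_in (coded_similarity K) (hard_stream K L N x i) t"
  proof (rule degree_ge_card)
    show "?J \<subseteq> {..<L + 2 * N}"
      using J_L assms(4) by (auto intro: trans_less_add1)
    fix j assume "j \<in> ?J"
    then consider "j = t" | "j \<in> {i * K..<i * K + K}"
      by blast
    then show "hard_similarity K (hard_item K L x i t) (hard_item K L x i j) = 1"
    proof cases
      case 2
      then show ?thesis
        using \<open>K > 0\<close> by (simp add: item_t block)
    qed (simp add: hard_similarity_refl)
  qed fact
  moreover have "card ?J = 1 + K"
    using J_L assms(3) by (subst card_insert_disjoint) fastforce+
  ultimately show ?thesis by simp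
qed

lemma card_parity_class:
  "card {t. L \<le> t \<and> t < L + 2 * N \<and> odd (t - L) = b} = (N :: nat)"
proof -
  have "{t. L \<le> t \<and> t < L + 2 * N \<and> odd (t - L) = b} = (\<lambda>u. L + (2 * u + of_bool b)) ` {..<N}"
  proof (intro equalityI subsetI)
    fix t assume t: "t \<in> {t. L \<le> t \<and> t < L + 2 * N \<and> odd (t - L) = b}"
    have "u = 2 * (u div 2) + of_bool b" if "odd u = b" for u :: nat
      using that by (cases b) (auto elim!: evenE oddE)
    then have "t - L = 2 * ((t - L) div 2) + of_bool b"
      using t by blast
    with t show "t \<in> (\<lambda>u. L + (2 * u + of_bool b)) ` {..<N}"
      by (intro image_eqI[of _ _ "(t - L) div 2"]) auto
  qed (auto split: if_splits)
  then show ?thesis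
    by (simp add: card_image inj_on_def)
qed

text \<open>Nodes voting correctly have total weight \<open>S \<ge> 39 * N\<close>, those voting
  wrongly at most \<open>N\<close>, and abstaining ones at most \<open>L \<le> N + 2\<close>. So
  \<open>S\<close> is at least half of the moment and survives a distortion by factors above
  \<open>0.1\<close> and below \<open>1.9\<close>.\<close>

lemma hard_stream_expected_score:
  fixes p \<epsilon> :: real and x :: "nat \<Rightarrow> bool"
  assumes samp: "L_Mp_sampler_at p \<epsilon> 0.49 (coded_similarity K) (hard_stream K L N x i) R"
    and \<epsilon>: "0 < \<epsilon>" "\<epsilon> < 0.9" and "p > 0" "K > 0" "N > 0"
    and K: "39 \<le> (1 + real K) powr p" and i: "(i + 1) * K \<le> L" and L: "L \<le> N + 2"
  shows "1 / 100 \<le> (\<integral>D. guess_score (x i) (bit_guess i (outcome D (hard_stream K L N x i))) \<partial>R)"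
proof -
  let ?n = "L + 2 * N"
  let ?\<sigma> = "hard_stream K L N x i"
  let ?q = "\<P>(D in R. outcome D ?\<sigma> \<noteq> None)"
  define P where "P t = \<P>(D in R. outcome D ?\<sigma> = Some (t, ?\<sigma> ! t))" for t
  define \<phi> where "\<phi> t = guess_score (x i) (bit_guess i (Some (t, ?\<sigma> ! t)))" for t
  define d where "d t = degree_in (coded_similarity K) ?\<sigma> t powr p" for t
  define M where "M = (\<Sum>t<?n. d t)"
  have len: "length ?\<sigma> = ?n"
    by (simp add: hard_stream_def)
  have M: "degree_moment p (coded_similarity K) ?\<sigma> = M"
    by (simp add: degree_moment_def M_def d_def len)
  note prob = sampler_node_probability[OF samp, unfolded len M, folded d_def P_def]
  have d1: "d t \<ge> 1" if "t < ?n" for t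
    unfolding d_def using degree_ge_1[OF that] \<open>p > 0\<close> by (simp add: ge_one_powr_ge_zero)
  have dbad: "d t = 1" if "t < ?n" "\<phi> t \<noteq> 1" for t
    unfolding d_def using degree_eq_1[OF \<open>K > 0\<close> that(1)] that(2) by (simp add: \<phi>_def)
  \<comment> \<open>In the language of communication complexity, Alice owns the \<open>L\<close>
    encoding nodes and Bob the \<open>2 * N\<close> query nodes.\<close>
  have \<phi>_Bob: "\<phi> t = (if odd (t - L) = x i then 1 else -1)" if "L \<le> t" "t < ?n" for t
    using that by (auto simp: \<phi>_def hard_stream_def hard_item_def)
  have \<phi>_Alice: "\<phi> t \<in> {0, 1}" if "t < L" for t
    using that by (auto simp: \<phi>_def hard_stream_def hard_item_def)
  have \<phi>_cases: "\<phi> t \<in> {0, 1, -1}" if "t < ?n" for t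
    using \<phi>_Bob[of t] \<phi>_Alice[of t] that by (cases "t < L") auto
  define S where "S = (\<Sum>t | t < ?n \<and> \<phi> t = 1. d t)"
  have split: "{..<?n} = {t. t < ?n \<and> \<phi> t = 1} \<union> {t. t < ?n \<and> \<phi> t = -1} \<union> {t. t < ?n \<and> \<phi> t = 0}"
    using \<phi>_cases by auto
  have sum_split: "(\<Sum>t<?n. h t) = (\<Sum>t | t < ?n \<and> \<phi> t = 1. h t) +
      (\<Sum>t | t < ?n \<and> \<phi> t = -1. h t) + (\<Sum>t | t < ?n \<and> \<phi> t = 0. h t)" for h :: "nat \<Rightarrow> real"
    by (subst split, subst sum.union_disjoint, simp, simp, force, subst sum.union_disjoint) auto
  have "{t. t < ?n \<and> \<phi> t = -1} \<subseteq> {t. L \<le> t \<and> t < ?n \<and> odd (t - L) = (\<not> x i)}"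
  proof (intro subsetI CollectI)
    fix t assume t: "t \<in> {t. t < ?n \<and> \<phi> t = -1}"
    then have "L \<le> t"
      using \<phi>_Alice[of t] by (cases "t < L") auto
    then show "L \<le> t \<and> t < ?n \<and> odd (t - L) = (\<not> x i)"
      using t \<phi>_Bob[of t] by (auto split: if_splits)
  qed
  then have "card {t. t < ?n \<and> \<phi> t = -1} \<le> card {t. L \<le> t \<and> t < ?n \<and> odd (t - L) = (\<not> x i)}"
    by (intro card_mono) auto
  then have card_bad: "card {t. t < ?n \<and> \<phi> t = -1} \<le> N"
    by (simp only: card_parity_class)
  have "{t. t < ?n \<and> \<phi> t = 0} \<subseteq> {..<L}"
  proof
    fix t assume "t \<in> {t. t < ?n \<and> \<phi> t = 0}"
    then show "t \<in> {..<L}"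
      using \<phi>_Bob[of t] by (cases "t < L") (auto split: if_splits)
  qed
  from card_mono[OF _ this] have card_neutral: "card {t. t < ?n \<and> \<phi> t = 0} \<le> L"
    by simp
  have S: "39 * real N \<le> S"
  proof -
    let ?G = "{t. L \<le> t \<and> t < ?n \<and> odd (t - L) = x i}"
    have "39 \<le> d t" if "t \<in> ?G" for t
    proof -
      have "(1 + real K) powr p \<le> d t"
        unfolding d_def using that \<open>p > 0\<close> degree_good[OF \<open>K > 0\<close> i, of t N x]
        by (intro powr_mono2) auto
      then show ?thesis using K by simp
    qed
    then have "(\<Sum>t\<in>?G. 39) \<le> (\<Sum>t\<in>?G. d t)"
      by (rule sum_mono)
    also have "\<dots> \<le> S"
      unfolding S_def using \<phi>_Bob by (intro sum_mono2) (auto simp: d_def simp del: even_diff_nat)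
    finally show ?thesis
      by (simp only: sum_constant card_parity_class)
  qed
  have "(\<Sum>t | t < ?n \<and> \<phi> t = -1. d t) = (\<Sum>t | t < ?n \<and> \<phi> t = -1. 1)"
    using dbad by (intro sum.cong) auto
  then have dm: "(\<Sum>t | t < ?n \<and> \<phi> t = -1. d t) \<le> real N"
    using card_bad by simp
  have "(\<Sum>t | t < ?n \<and> \<phi> t = 0. d t) = (\<Sum>t | t < ?n \<and> \<phi> t = 0. 1)"
    using dbad by (intro sum.cong) auto
  then have "(\<Sum>t | t < ?n \<and> \<phi> t = 0. d t) \<le> real N + 2"
    using card_neutral L by simp
  then have M_le: "M \<le> 2 * S"
    unfolding M_def sum_split[of d] S_def[symmetric] using dm S \<open>N > 0\<close> by simp
  have "M > 0"
    unfolding M_def using d1 \<open>N > 0\<close> by (intro sum_pos) (auto simp: lessThan_empty_iff intro: less_le_trans[OF zero_less_one])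
  have q: "?q \<ge> 0.51"
    using prob(1)[of 0] \<open>N > 0\<close> by simp
  have good: "?q / M * ((1 - \<epsilon>) * S) \<le> (\<Sum>t | t < ?n \<and> \<phi> t = 1. P t)"
    unfolding S_def sum_distrib_left using prob(2) by (intro sum_mono) (auto simp: mult_ac)
  have bad: "(\<Sum>t | t < ?n \<and> \<phi> t = -1. P t) \<le> ?q / M * ((1 + \<epsilon>) * real N)"
  proof -
    have "(\<Sum>t | t < ?n \<and> \<phi> t = -1. P t) \<le> (\<Sum>t | t < ?n \<and> \<phi> t = -1. ?q / M * ((1 + \<epsilon>) * d t))"
      using prob(3) by (intro sum_mono) (auto simp: mult_ac)
    also have "\<dots> = ?q / M * ((1 + \<epsilon>) * (\<Sum>t | t < ?n \<and> \<phi> t = -1. d t))"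
      by (simp add: sum_distrib_left)
    also have "\<dots> \<le> ?q / M * ((1 + \<epsilon>) * real N)"
      using dm \<open>M > 0\<close> q \<epsilon> by (intro mult_left_mono) auto
    finally show ?thesis .
  qed
  have "0.1 * S \<le> (1 - \<epsilon>) * S"
    using \<epsilon> S by (intro mult_right_mono) auto
  moreover have "(1 + \<epsilon>) * real N \<le> 1.9 * real N"
    using \<epsilon> by (intro mult_right_mono) auto
  \<comment> \<open>Break-even would be \<open>S = 19 * N\<close>. With
    \<open>S \<ge> 39 * N\<close> the difference is at least \<open>(0.1 - 1.9 / 39) * S\<close>,
    which exceeds \<open>S / 25\<close>, and \<open>M \<le> 2 * S\<close>.\<close>
  ultimately have gap: "M / 50 \<le> (1 - \<epsilon>) * S - (1 + \<epsilon>) * real N"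
    using S M_le by simp
  \<comment> \<open>Uses \<open>0.51 / 50 \<ge> 1 / 100\<close>, where \<open>0.51\<close> bounds
    the success probability from below.\<close>
  have "1 / 100 \<le> ?q / M * (M / 50)"
    using q \<open>M > 0\<close> by simp
  also have "\<dots> \<le> ?q / M * ((1 - \<epsilon>) * S - (1 + \<epsilon>) * real N)"
    using gap q \<open>M > 0\<close> by (intro mult_left_mono) auto
  also have "\<dots> \<le> (\<Sum>t | t < ?n \<and> \<phi> t = 1. P t) - (\<Sum>t | t < ?n \<and> \<phi> t = -1. P t)"
    using good bad by (simp add: right_diff_distrib)
  also have "\<dots> = (\<Sum>t<?n. \<phi> t * P t)"
    unfolding sum_split[of "\<lambda>t. \<phi> t * P t"] by (simp add: sum_negf)
  also have "\<dots> = (\<integral>D. guess_score (x i) (bit_guess i (outcome D ?\<sigma>)) \<partial>R)"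
    using sampler_expectation(2)[OF samp, of "\<lambda>r. guess_score (x i) (bit_guess i r)"]
    by (simp add: len \<phi>_def P_def)
  finally show ?thesis .
qed

section \<open>The space bound\<close>

lemma card_short_bit_strings:
  "finite {c :: bool list. length c \<le> s}" "card {c :: bool list. length c \<le> s} \<le> 2 ^ (s + 1)"
proof -
  have "finite {c :: bool list. set c \<subseteq> UNIV \<and> length c \<le> s}"
    by (rule finite_lists_length_le) simp
  then show "finite {c :: bool list. length c \<le> s}"
    by simp
  have "card {c :: bool list. set c \<subseteq> UNIV \<and> length c \<le> s} = (\<Sum>i\<le>s. 2 ^ i)"
    by (subst card_lists_length_le) (auto simp: card_UNIV_bool)
  also have "\<dots> < 2 ^ (s + 1)"
    by (induction s) auto
  finally show "card {c :: bool list. length c \<le> s} \<le> 2 ^ (s + 1)"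
    by simp
qed

text \<open>Averaging over the random bits fixes one deterministic algorithm whose mean score over
  all \<open>x\<close> and \<open>i\<close> is at least \<open>1 / 100\<close>. Its memory after the
  encoding part is a message, so the counting bound with \<open>\<gamma> = 1 / 100\<close> gives
  \<open>exp (m / 20000) \<le> 2 ^ (s + 1)\<close>.\<close>

lemma sampler_space_lower_bound:
  fixes A :: "nat set \<Rightarrow> (nat \<Rightarrow> nat \<Rightarrow> real) \<Rightarrow> nat streaming_alg measure"
  assumes samp: "L_Mp_sampler p \<epsilon> 0.49 (L + 2 * N) A"
    and space: "uses_at_most_bits B (L + 2 * N) A s"
    and \<epsilon>: "0 < \<epsilon>" "\<epsilon> < 0.9" and "p > 0" "K > 0" "N > 0"
    and K: "39 \<le> (1 + real K) powr p" and L: "L \<le> N + 2"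
    and B: "(L + 1) * (2 * (K + 2 * N)) \<le> B"
  shows "real (L div K) / 20000 \<le> real s + 1"
proof -
  \<comment> \<open>Only complete blocks encode a bit. The remaining \<open>L mod K\<close> encoding
    items have index \<open>m\<close>, which is never queried.\<close>
  define m where "m = L div K"
  define U where "U = hard_universe K L N"
  define f where "f = coded_similarity K"
  define R where "R = A U f"
  define X where "X = PiE {..<m} (\<lambda>_. UNIV :: bool set)"
  define score where "score x i D = guess_score (x i) (bit_guess i (outcome D (hard_stream K L N x i)))"
    for x i D
  have finX: "finite X" and cardX: "real (card X) = 2 ^ m"
    unfolding X_def by (auto intro!: finite_PiE simp: card_PiE)
  have block: "(i + 1) * K \<le> L" "i \<le> L" if "i < m" for i
  proof -
    have "(i + 1) * K \<le> m * K"
      using that by (intro mult_le_mono1) simp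
    also have "\<dots> \<le> L"
      unfolding m_def by simp
    finally show "(i + 1) * K \<le> L" .
    moreover have "i * 1 \<le> (i + 1) * K"
      using \<open>K > 0\<close> by (intro mult_le_mono) auto
    ultimately show "i \<le> L" by simp
  qed
  have stream: "hard_stream K L N x i \<in> streams_of_length (L + 2 * N) U" if "i \<le> L" for x i
    unfolding U_def using \<open>K > 0\<close> that by (rule hard_stream_in_streams)
  have samp_at: "L_Mp_sampler_at p \<epsilon> 0.49 f (hard_stream K L N x i) R" if "i \<le> L" for x i
    using samp stream[OF that] similarity_on_coded[of U K]
    unfolding L_Mp_sampler_def R_def f_def by blast
  interpret prob_space R
    using samp_at[of 0] by (simp add: L_Mp_sampler_at_def)
  have int: "integrable R (score x i)" if "i < m" for x i
    unfolding score_def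
    using sampler_expectation(1)[OF samp_at[OF block(2)[OF that]], of "\<lambda>r. guess_score (x i) (bit_guess i r)"]
    by simp
  have "real m * 2 ^ m / 100 = (\<Sum>x\<in>X. \<Sum>i<m. 1 / 100)"
    by (simp add: cardX)
  also have "\<dots> \<le> (\<Sum>x\<in>X. \<Sum>i<m. expectation (score x i))"
  proof (intro sum_mono)
    fix x i assume "i \<in> {..<m}"
    then have "i < m" by simp
    from hard_stream_expected_score[OF samp_at[OF block(2)[OF this], unfolded f_def] \<epsilon>
        \<open>p > 0\<close> \<open>K > 0\<close> \<open>N > 0\<close> K block(1)[OF this] L]
    show "1 / 100 \<le> expectation (score x i)"
      unfolding score_def .
  qed
  also have "\<dots> = expectation (\<lambda>D. \<Sum>x\<in>X. \<Sum>i<m. score x i D)"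
    using int by (subst Bochner_Integration.integral_sum; (intro sum.cong refl)?)
      (auto simp: Bochner_Integration.integral_sum intro!: Bochner_Integration.integrable_sum)
  finally have mean: "real m * 2 ^ m / 100 \<le> expectation (\<lambda>D. \<Sum>x\<in>X. \<Sum>i<m. score x i D)" .
  \<comment> \<open>If every deterministic algorithm scored strictly less, so would the
    expectation.\<close>
  have "\<exists>D\<in>space R. real m * 2 ^ m / 100 \<le> (\<Sum>x\<in>X. \<Sum>i<m. score x i D)"
  proof (rule ccontr)
    assume "\<not> ?thesis"
    then have less: "AE D in R. (\<Sum>x\<in>X. \<Sum>i<m. score x i D) < real m * 2 ^ m / 100"
      by (intro AE_I2) (auto simp: not_le)
    have "integrable R (\<lambda>D. \<Sum>x\<in>X. \<Sum>i<m. score x i D)"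
      using int by (intro Bochner_Integration.integrable_sum) auto
    from expectation_less[OF this less] mean show False
      by simp
  qed
  then obtain D where D: "D \<in> space R"
    and score_D: "real m * 2 ^ m / 100 \<le> (\<Sum>x\<in>X. \<Sum>i<m. score x i D)"
    by blast
  \<comment> \<open>Query index \<open>0\<close> is an arbitrary choice: the memory after the first
    \<open>L\<close> nodes is the same for every query.\<close>
  define \<mu> where "\<mu> x = memory_after D (take L (List.enumerate 0 (hard_stream K L N x 0)))" for x
  obtain g where g: "\<And>x i. outcome D (hard_stream K L N x i) =
      g (memory_after D (take L (List.enumerate 0 (hard_stream K L N x i)))) i"
    using outcome_hard_stream[of D K L N] by blast
  have g: "outcome D (hard_stream K L N x i) = g (\<mu> x) i" for x i
    unfolding \<mu>_def by (subst memory_prefix_hard_stream[of D L K N x 0 i]) (rule g)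
  have "length (\<mu> x) \<le> s" for x
  proof -
    have "finite U \<and> card U \<le> B \<and> similarity_on U f"
      using B by (simp add: U_def f_def finite_hard_universe card_hard_universe similarity_on_coded)
    moreover have "L \<le> L + 2 * N" by simp
    ultimately show ?thesis
      using space stream[of 0 x] D unfolding uses_at_most_bits_def R_def \<mu>_def by blast
  qed
  then have "card (\<mu> ` X) \<le> card {c :: bool list. length c \<le> s}"
    by (intro card_mono card_short_bit_strings) auto
  then have card: "real (card (\<mu> ` X)) \<le> 2 ^ (s + 1)"
    using card_short_bit_strings(2)[of s] by (metis of_nat_le_iff of_nat_numeral of_nat_power order_trans)
  have "exp ((1/100)\<^sup>2 * real m / 2) \<le> real (card (\<mu> ` X))"
    unfolding X_def
    by (rule card_messages_ge_exp[where g = "\<lambda>c i. bit_guess i (g c i)"])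
      (use score_D in \<open>simp_all add: score_def g X_def\<close>)
  also note card
  also have "(2::real) ^ (s + 1) \<le> exp 1 ^ (s + 1)"
    using exp_ge_add_one_self[of 1] by (intro power_mono) auto
  also have "\<dots> = exp (real s + 1)"
    by (simp add: exp_add mult.commute flip: exp_of_nat_mult)
  finally show ?thesis
    by (simp add: m_def power2_eq_square)
qed

section \<open>Choice of block size, stream split and universe cap for given \<open>p\<close> and
  \<open>n\<close>\<close>

theorem theorem20:
  fixes p :: real
  assumes "p > 0"
  shows "\<exists>c>0. \<exists>k::nat. \<exists>n\<^sub>0::nat. \<forall>n\<ge>n\<^sub>0. \<forall>\<epsilon>::real. 0 < \<epsilon> \<and> \<epsilon> < 0.9 \<longrightarrow>
    (\<forall>(A :: nat set \<Rightarrow> (nat \<Rightarrow> nat \<Rightarrow> real) \<Rightarrow> nat streaming_alg measure) (s::nat).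
       L_Mp_sampler p \<epsilon> 0.49 n A \<and> uses_at_most_bits (n ^ k) n A s \<longrightarrow> c * real n \<le> real s)"
proof -
  define K where "K = nat \<lceil>39 powr (1 / p)\<rceil>"
  have K_ge: "39 powr (1 / p) \<le> real K"
    unfolding K_def by linarith
  moreover have "39 powr (1 / p) > (0 :: real)"
    by simp
  ultimately have "K > 0"
    by (metis gr0I not_le of_nat_0)
  have "39 = (39 powr (1 / p)) powr p"
    using assms by (simp add: powr_powr)
  also have "\<dots> \<le> (1 + real K) powr p"
    using assms K_ge by (intro powr_mono2) auto
  finally have K: "39 \<le> (1 + real K) powr p" .
  \<comment> \<open>The space bound yields about \<open>n / (60000 * K)\<close> bits. Half of this
    absorbs the loss from rounding \<open>L / K\<close> down and the \<open>+ 1\<close> in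
    \<open>s + 1\<close>, as \<open>n / (120000 * K) \<ge> 2\<close>.\<close>
  have bound: "real n / (120000 * real K) \<le> real s"
    if n: "n \<ge> 240000 * K" and \<epsilon>: "0 < \<epsilon>" "\<epsilon> < 0.9"
      and A: "L_Mp_sampler p \<epsilon> 0.49 n A" "uses_at_most_bits (n ^ 3) n A s"
    for n s \<epsilon> and A :: "nat set \<Rightarrow> (nat \<Rightarrow> nat \<Rightarrow> real) \<Rightarrow> nat streaming_alg measure"
  proof -
    \<comment> \<open>A split into near thirds: \<open>L\<close> takes the remainder of the
      division, hence the \<open>+ 2\<close> in \<open>L \<le> N + 2\<close>.\<close>
    define N L where "N = n div 3" and "L = n - 2 * N"
    have nLN: "n = L + 2 * N" and L: "L \<le> N + 2" "n \<le> 3 * L" and "N > 0"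
      and sizes: "L + 1 \<le> n" "2 \<le> n" "K + 2 * N \<le> n"
      using n \<open>K > 0\<close> unfolding N_def L_def by linarith+
    \<comment> \<open>The left side is the size of the hard universe; three factors of at most
      \<open>n\<close> explain the cap \<open>n ^ 3\<close>.\<close>
    have "(L + 1) * (2 * (K + 2 * N)) \<le> n * (n * n)"
      using sizes by (intro mult_le_mono)
    then have "(L + 1) * (2 * (K + 2 * N)) \<le> n ^ 3"
      by (simp only: power3_eq_cube mult.assoc)
    then have "real (L div K) / 20000 \<le> real s + 1"
      by (intro sampler_space_lower_bound[OF A(1)[unfolded nLN] A(2)[unfolded nLN] \<epsilon>
          assms \<open>K > 0\<close> \<open>N > 0\<close> K L(1)]) (simp only: nLN)
    moreover have "real L / real K < real (L div K) + 1"
      using \<open>K > 0\<close> by (metis add.commute floor_divide_of_nat_eq of_int_of_nat_eq real_of_int_floor_add_one_gt)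
    moreover have "real n / (3 * real K) \<le> real L / real K"
      using L(2) \<open>K > 0\<close> by (simp add: field_simps)
    moreover have "80000 \<le> real n / (3 * real K)"
      using n \<open>K > 0\<close> by (simp add: field_simps flip: of_nat_mult)
    ultimately show ?thesis
      by (simp add: field_simps)
  qed
  show ?thesis
  proof (intro exI conjI allI impI)
    show "1 / (120000 * real K) > 0"
      using \<open>K > 0\<close> by simp
  \<comment> \<open>The witnesses \<open>3\<close> for \<open>k\<close> and
    \<open>240000 * K\<close> for \<open>n\<^sub>0\<close> are found by unification with
    \<open>bound\<close>.\<close>
  qed (use bound in auto)
qed

end
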